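(* Let $R$ be a commutative ring and let $\mathfrak{a}\subseteq R$ be an ideal. If $\mathfrak{a}$ is principal, then every $R$-module is weakly $\mathfrak{a}$-fair.
   Context: Rings are commutative with unit (not assumed noetherian). $\mathrm{Var}(\mathfrak{a})$ is the set of prime ideals of $R$ containing $\mathfrak{a}$, and for an $R$-module $M$, $\Gamma_{\mathfrak{a}}(M)=\{x\in M\mid\exists n\in\mathbb{N}:\mathfrak{a}^nx=0\}$. For $x\in M$, $(0:_Rx)=\{r\in R\mid rx=0\}$. The weak assassin $\mathrm{Ass}^{\rm f}_R(M)$ is the set of prime ideals $\mathfrak{p}$ of $R$ such that there exists $x\in M$ for which $\mathfrak{p}$ is minimal (with respect to inclusion) among the prime ideals containing $(0:_Rx)$. An $R$-module $M$ is called weakly $\mathfrak{a}$-fair if $\mathrm{Ass}^{\rm f}_R(M/\Gamma_{\mathfrak{a}}(M))=\mathrm{Ass}^{\rm f}_R(M)\setminus\mathrm{Var}(\mathfrak{a})$. *)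

theory Defs
  imports "HOL-Algebra.Module" "HOL-Algebra.QuotRing" "HOL-Algebra.Ideal_Product"
begin

definition Var :: "('r, 'x) ring_scheme \<Rightarrow> 'r set \<Rightarrow> 'r set set"
  where "Var R I = {p. primeideal p R \<and> I \<subseteq> p}"

definition annihilator :: "('r, 'x) ring_scheme \<Rightarrow> ('r, 'm, 'y) module_scheme \<Rightarrow> 'm \<Rightarrow> 'r set"
  where "annihilator R M x = {r \<in> carrier R. r \<odot>\<^bsub>M\<^esub> x = \<zero>\<^bsub>M\<^esub>}"

text \<open>The power is taken in the multiplicative monoid of ideals of the ring \<open>R\<close>,
  so the zeroth power of an ideal is \<open>carrier R\<close>.\<close>

definition torsion :: "('r, 'x) ring_scheme \<Rightarrow> 'r set \<Rightarrow> ('r, 'm, 'y) module_scheme \<Rightarrow> 'm set"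
  where "torsion R I M =
    {x \<in> carrier M. \<exists>n::nat. \<forall>r \<in> I [^]\<^bsub>ideals_set R\<^esub> n. r \<odot>\<^bsub>M\<^esub> x = \<zero>\<^bsub>M\<^esub>}"

text \<open>The module record extends the ring record. Its fields \<open>mult\<close> and \<open>one\<close> play no role
  in the locale \<open>module\<close> and are left unspecified. Scalar multiplication follows the
  pattern of \<open>rcoset_mult\<close>.\<close>

definition quotient_module :: "('r, 'm, 'y) module_scheme \<Rightarrow> 'm set \<Rightarrow> ('r, 'm set) module"
  where "quotient_module M N =
    \<lparr>carrier = a_rcosets\<^bsub>M\<^esub> N, mult = undefined, one = undefined,
     zero = N, add = set_add M,
     smult = (\<lambda>r X. \<Union>x\<in>X. N +>\<^bsub>M\<^esub> (r \<odot>\<^bsub>M\<^esub> x))\<rparr>"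

definition weak_assassin :: "('r, 'x) ring_scheme \<Rightarrow> ('r, 'm, 'y) module_scheme \<Rightarrow> 'r set set"
  where "weak_assassin R M =
    {p. primeideal p R \<and>
        (\<exists>x \<in> carrier M. p \<in> Var R (annihilator R M x) \<and>
           (\<forall>q \<in> Var R (annihilator R M x). q \<subseteq> p \<longrightarrow> q = p))}"

definition weakly_fair :: "('r, 'x) ring_scheme \<Rightarrow> 'r set \<Rightarrow> ('r, 'm, 'y) module_scheme \<Rightarrow> bool"
  where "weakly_fair R I M \<longleftrightarrow>
    weak_assassin R (quotient_module M (torsion R I M)) = weak_assassin R M - Var R I"

context module
begin

lemma submodule_abelian_subgroup:
  assumes "submodule N R M"
  shows "abelian_subgroup N M"
  using assms M.abelian_group_axioms
  by (intro abelian_subgroupI3 additive_subgroupI) (auto simp: submodule_def)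

lemma quotient_module_smult:
  assumes N: "submodule N R M" and r: "r \<in> carrier R" and x: "x \<in> carrier M"
  shows "r \<odot>\<^bsub>quotient_module M N\<^esub> (N +>\<^bsub>M\<^esub> x) = N +>\<^bsub>M\<^esub> (r \<odot>\<^bsub>M\<^esub> x)"
proof -
  interpret N: abelian_subgroup N M by (rule submodule_abelian_subgroup[OF N])
  have eq: "N +>\<^bsub>M\<^esub> (r \<odot>\<^bsub>M\<^esub> y) = N +>\<^bsub>M\<^esub> (r \<odot>\<^bsub>M\<^esub> x)" if y: "y \<in> N +>\<^bsub>M\<^esub> x" for y
  proof -
    obtain n where n: "n \<in> N" "y = n \<oplus>\<^bsub>M\<^esub> x"
      using y by (auto simp: a_r_coset_def')
    have nc: "n \<in> carrier M" using n N.a_subset by auto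
    have "r \<odot>\<^bsub>M\<^esub> y = (r \<odot>\<^bsub>M\<^esub> n) \<oplus>\<^bsub>M\<^esub> (r \<odot>\<^bsub>M\<^esub> x)"
      using n nc r x by (simp add: smult_r_distr)
    moreover have "r \<odot>\<^bsub>M\<^esub> n \<in> N" using submodule.smult_closed[OF N r n(1)] .
    ultimately have "r \<odot>\<^bsub>M\<^esub> y \<in> N +>\<^bsub>M\<^esub> (r \<odot>\<^bsub>M\<^esub> x)" by (auto simp: a_r_coset_def')
    then show ?thesis
      using N.a_repr_independence' r x by blast
  qed
  have "x \<in> N +>\<^bsub>M\<^esub> x" using N.a_rcos_self[OF x] .
  then have "(\<Union>y\<in>N +>\<^bsub>M\<^esub> x. N +>\<^bsub>M\<^esub> (r \<odot>\<^bsub>M\<^esub> y)) = N +>\<^bsub>M\<^esub> (r \<odot>\<^bsub>M\<^esub> x)"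
    using eq by blast
  then show ?thesis by (simp add: quotient_module_def)
qed

lemma quotient_module_is_module:
  assumes N: "submodule N R M"
  shows "module R (quotient_module M N)"
proof -
  interpret N: abelian_subgroup N M by (rule submodule_abelian_subgroup[OF N])
  let ?Q = "quotient_module M N"
  have carr: "carrier ?Q = (\<lambda>x. N +>\<^bsub>M\<^esub> x) ` carrier M"
    by (auto simp: quotient_module_def A_RCOSETS_def')
  have add: "(N +>\<^bsub>M\<^esub> x) \<oplus>\<^bsub>?Q\<^esub> (N +>\<^bsub>M\<^esub> y) = N +>\<^bsub>M\<^esub> (x \<oplus>\<^bsub>M\<^esub> y)"
    if "x \<in> carrier M" "y \<in> carrier M" for x y
    using that by (simp add: quotient_module_def N.a_rcos_sum)
  have zero: "\<zero>\<^bsub>?Q\<^esub> = N +>\<^bsub>M\<^esub> \<zero>\<^bsub>M\<^esub>"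
    using N.a_subset by (force simp: quotient_module_def a_r_coset_def')
  show ?thesis
  proof (rule moduleI)
    show "cring R" by (rule R.is_cring)
    show "abelian_group ?Q"
    proof (rule abelian_groupI)
      fix X assume "X \<in> carrier ?Q"
      then obtain x where x: "x \<in> carrier M" "X = N +>\<^bsub>M\<^esub> x" by (auto simp: carr)
      then show "\<exists>Y\<in>carrier ?Q. Y \<oplus>\<^bsub>?Q\<^esub> X = \<zero>\<^bsub>?Q\<^esub>"
        by (intro bexI[of _ "N +>\<^bsub>M\<^esub> (\<ominus>\<^bsub>M\<^esub> x)"]) (auto simp: add zero carr M.l_neg)
    next
      fix X Y assume "X \<in> carrier ?Q" "Y \<in> carrier ?Q"
      then show "X \<oplus>\<^bsub>?Q\<^esub> Y = Y \<oplus>\<^bsub>?Q\<^esub> X"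
        unfolding carr by (elim imageE) (simp only: add M.a_comm)
    qed (auto simp: carr add zero M.a_assoc)
  qed (auto simp: carr add quotient_module_smult[OF N]
        smult_l_distr smult_r_distr smult_assoc1)
qed

lemma torsion_is_submodule:
  assumes "ideal I R"
  shows "submodule (torsion R I M) R M"
proof -
  interpret S: comm_monoid "ideals_set R" by (rule R.ideals_set_is_comm_monoid)
  have I: "I \<in> carrier (ideals_set R)" using assms by (simp add: ideals_set_def)
  have pow: "ideal (I [^]\<^bsub>ideals_set R\<^esub> n) R" for n :: nat
    using S.nat_pow_closed[OF I, of n] by (simp add: ideals_set_def)
  have carr: "r \<in> carrier R" if "r \<in> I [^]\<^bsub>ideals_set R\<^esub> n" for r and n :: nat
    using ideal.Icarr[OF pow that] .
  have sub: "I [^]\<^bsub>ideals_set R\<^esub> (n + k)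
      \<subseteq> I [^]\<^bsub>ideals_set R\<^esub> n \<inter> I [^]\<^bsub>ideals_set R\<^esub> k" for n k :: nat
  proof -
    have "I [^]\<^bsub>ideals_set R\<^esub> (n + k)
        = ideal_prod R (I [^]\<^bsub>ideals_set R\<^esub> n) (I [^]\<^bsub>ideals_set R\<^esub> k)"
      using S.nat_pow_mult[OF I, of n k] by (simp add: ideals_set_def)
    then show ?thesis using R.ideal_prod_inter[OF pow pow] by metis
  qed
  show ?thesis
  proof (rule submoduleI)
    show "torsion R I M \<subseteq> carrier M" by (auto simp: torsion_def)
    show "\<zero>\<^bsub>M\<^esub> \<in> torsion R I M" by (auto simp: torsion_def intro: smult_r_null carr)
    show "\<ominus>\<^bsub>M\<^esub> x \<in> torsion R I M" if xt: "x \<in> torsion R I M" for x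
    proof -
      obtain n :: nat where x: "x \<in> carrier M"
        and n: "\<forall>r \<in> I [^]\<^bsub>ideals_set R\<^esub> n. r \<odot>\<^bsub>M\<^esub> x = \<zero>\<^bsub>M\<^esub>"
        using xt by (auto simp: torsion_def)
      have "\<forall>r \<in> I [^]\<^bsub>ideals_set R\<^esub> n. r \<odot>\<^bsub>M\<^esub> (\<ominus>\<^bsub>M\<^esub> x) = \<zero>\<^bsub>M\<^esub>"
        using n x by (simp add: carr smult_r_minus)
      then show ?thesis using x unfolding torsion_def by blast
    qed
    show "x \<oplus>\<^bsub>M\<^esub> y \<in> torsion R I M" if xt: "x \<in> torsion R I M" "y \<in> torsion R I M" for x y
    proof -
      obtain n k :: nat where x: "x \<in> carrier M" and y: "y \<in> carrier M"
        and n: "\<forall>r \<in> I [^]\<^bsub>ideals_set R\<^esub> n. r \<odot>\<^bsub>M\<^esub> x = \<zero>\<^bsub>M\<^esub>"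
        and k: "\<forall>r \<in> I [^]\<^bsub>ideals_set R\<^esub> k. r \<odot>\<^bsub>M\<^esub> y = \<zero>\<^bsub>M\<^esub>"
        using xt by (auto simp: torsion_def)
      have "r \<odot>\<^bsub>M\<^esub> (x \<oplus>\<^bsub>M\<^esub> y) = \<zero>\<^bsub>M\<^esub>" if r: "r \<in> I [^]\<^bsub>ideals_set R\<^esub> (n + k)" for r
      proof -
        have "r \<odot>\<^bsub>M\<^esub> x = \<zero>\<^bsub>M\<^esub>" "r \<odot>\<^bsub>M\<^esub> y = \<zero>\<^bsub>M\<^esub>" using n k r sub by blast+
        then show ?thesis using carr[OF r] x y by (simp add: smult_r_distr)
      qed
      then show ?thesis using x y unfolding torsion_def by blast
    qed
    show "a \<odot>\<^bsub>M\<^esub> x \<in> torsion R I M" if a: "a \<in> carrier R" and xt: "x \<in> torsion R I M" for a x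
    proof -
      obtain n :: nat where x: "x \<in> carrier M"
        and n: "\<forall>r \<in> I [^]\<^bsub>ideals_set R\<^esub> n. r \<odot>\<^bsub>M\<^esub> x = \<zero>\<^bsub>M\<^esub>"
        using xt by (auto simp: torsion_def)
      have "r \<odot>\<^bsub>M\<^esub> (a \<odot>\<^bsub>M\<^esub> x) = \<zero>\<^bsub>M\<^esub>" if r: "r \<in> I [^]\<^bsub>ideals_set R\<^esub> n" for r
        using n r a x carr[OF r] ideal.I_r_closed[OF pow r a]
        by (simp flip: smult_assoc1)
      then show ?thesis using a x unfolding torsion_def by blast
    qed
  qed
qed

end

end

theory Submission
  imports Defs
begin

text \<open>
  A prime \<open>p\<close> containing an ideal \<open>I\<close> is minimal over \<open>I\<close> if and only if all its elements
  become nilpotent modulo \<open>I\<close> after localising at \<open>p\<close>: every \<open>r \<in> p\<close> satisfies \<open>s r\<^sup>n \<in> I\<close> for some \<open>s \<notin> p\<close> and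
  some \<open>n\<close> (lemma \<open>minimal_prime_iff\<close>). This turns membership in the weak assassin into
  a statement about elements.

  Suppose now that \<open>\<aa>\<close> is generated by \<open>a\<close>, and write \<open>\<Gamma>\<close> for the \<open>\<aa>\<close>-torsion submodule of \<open>M\<close>. Then
  \<open>x \<in> \<Gamma>\<close> if and only if \<open>a\<^sup>n x = 0\<close> for some \<open>n\<close>, so the annihilator of the class of \<open>x\<close> in
  \<open>M / \<Gamma>\<close> is the set of all \<open>r\<close> with \<open>a\<^sup>n r x = 0\<close> for some \<open>n\<close>. If \<open>a \<notin> p\<close>, the factors
  \<open>a\<^sup>n\<close> can be absorbed into the multiplier \<open>s \<notin> p\<close>, so \<open>p\<close> is minimal over the
  annihilator of \<open>x\<close> if and only if it is minimal over the annihilator of the class of \<open>x\<close>: the same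
  element witnesses membership in both weak assassins. If instead \<open>a \<in> p\<close>, then \<open>p\<close> cannot belong to
  the weak assassin of \<open>M / \<Gamma>\<close>: from \<open>s a\<^sup>n x \<in> \<Gamma>\<close> with \<open>s \<notin> p\<close> it follows that \<open>s x \<in> \<Gamma>\<close>, so
  \<open>s\<close> annihilates the class of \<open>x\<close> without lying in \<open>p\<close>.
\<close>

section \<open>Minimal primes over an ideal\<close>

lemma (in ring) ideal_Union_chain:
  assumes ne: "C \<noteq> {}" and chain: "subset.chain {J. ideal J R} C"
  shows "ideal (\<Union>C) R"
proof -
  have id: "ideal J R" if "J \<in> C" for J
    using chain that unfolding subset_chain_def by blast
  have add: "additive_subgroup J R" if "J \<in> C" for J
    using id[OF that] by (rule ideal.axioms(1))
  show ?thesis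
  proof (rule idealI[OF ring_axioms])
    show "subgroup (\<Union>C) (add_monoid R)"
    proof (rule add.subgroupI)
      show "\<Union>C \<subseteq> carrier R" using ideal.Icarr[OF id] by blast
      obtain J where "J \<in> C" using ne by auto
      then show "\<Union>C \<noteq> {}" using additive_subgroup.zero_closed[OF add] by blast
      show "\<ominus> x \<in> \<Union>C" if x: "x \<in> \<Union>C" for x
        using x
      proof
        fix J assume "x \<in> J" "J \<in> C"
        then show ?thesis using additive_subgroup.a_inv_closed[OF add] by (intro UnionI)
      qed
      fix x y assume "x \<in> \<Union>C" "y \<in> \<Union>C"
      then obtain J K where J: "J \<in> C" "x \<in> J" and K: "K \<in> C" "y \<in> K" by blast
      then have "J \<subseteq> K \<or> K \<subseteq> J"
        using chain unfolding subset_chain_def by blast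
      then obtain L where L: "L \<in> C" "x \<in> L" "y \<in> L" using J K by blast
      show "x \<oplus> y \<in> \<Union>C"
        using additive_subgroup.a_closed[OF add[OF L(1)] L(2,3)] L(1) by (rule UnionI[rotated])
    qed
  next
    fix x r assume "x \<in> \<Union>C" and r: "r \<in> carrier R"
    then obtain J where J: "J \<in> C" "x \<in> J" by blast
    show "r \<otimes> x \<in> \<Union>C"
      using J(1) ideal.I_l_closed[OF id[OF J(1)] J(2) r] by (rule UnionI)
    show "x \<otimes> r \<in> \<Union>C"
      using J(1) ideal.I_r_closed[OF id[OF J(1)] J(2) r] by (rule UnionI)
  qed
qed

text \<open>Krull's separation lemma: an ideal maximal among those that contain \<open>I\<close> and
  avoid \<open>S\<close> is prime. Enlarging it by an element outside it makes it meet \<open>S\<close>; if two such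
  elements had their product in the ideal, the product of the two points of \<open>S\<close> so reached would
  lie both in \<open>S\<close> and in the ideal.\<close>

lemma (in cring) prime_avoiding_multiplicative_set:
  assumes I: "ideal I R" and S: "S \<subseteq> carrier R" "\<one> \<in> S"
    and mult: "\<And>s t. \<lbrakk>s \<in> S; t \<in> S\<rbrakk> \<Longrightarrow> s \<otimes> t \<in> S"
    and disj: "I \<inter> S = {}"
  obtains q where "primeideal q R" "I \<subseteq> q" "q \<inter> S = {}"
proof -
  let ?A = "{J. ideal J R \<and> I \<subseteq> J \<and> J \<inter> S = {}}"
  have "\<exists>q\<in>?A. \<forall>X\<in>?A. q \<subseteq> X \<longrightarrow> X = q"
  proof (rule subset_Zorn_nonempty)
    show "?A \<noteq> {}" using I disj by blast
    fix C assume C: "C \<noteq> {}" "subset.chain ?A C"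
    then have chain: "subset.chain {J. ideal J R} C" and sub: "C \<subseteq> ?A"
      by (auto simp: pred_on.chain_def)
    have "ideal (\<Union>C) R" by (rule ideal_Union_chain[OF C(1) chain])
    then show "\<Union>C \<in> ?A" using C(1) sub by blast
  qed
  then obtain q where q: "ideal q R" "I \<subseteq> q" "q \<inter> S = {}"
    and max: "\<And>X. \<lbrakk>ideal X R; I \<subseteq> X; X \<inter> S = {}; q \<subseteq> X\<rbrakk> \<Longrightarrow> X = q" by auto
  interpret q: ideal q R by (rule q(1))
  have meet: "\<exists>u\<in>q. \<exists>r\<in>carrier R. u \<oplus> r \<otimes> a \<in> S" if a: "a \<in> carrier R" "a \<notin> q" for a
  proof -
    let ?X = "q <+>\<^bsub>R\<^esub> PIdl a"
    have X: "ideal ?X R" using add_ideals[OF q(1) cgenideal_ideal[OF a(1)]] .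
    have mem: "u \<oplus> r \<otimes> a \<in> ?X" if "u \<in> q" "r \<in> carrier R" for u r
      using that by (auto simp: set_add_defs cgenideal_def)
    have "q \<subseteq> ?X"
      using mem[of _ \<zero>] a(1) q.Icarr by auto
    moreover have "a \<in> ?X"
      using mem[of \<zero> \<one>] a(1) q.zero_closed by simp
    ultimately have "?X \<inter> S \<noteq> {}" using max[OF X] q(2) a(2) by blast
    then show ?thesis by (auto simp: set_add_defs cgenideal_def)
  qed
  have "primeideal q R"
  proof (rule primeidealI[OF q(1) is_cring])
    show "carrier R \<noteq> q" using S q(3) by blast
    fix a b assume a: "a \<in> carrier R" and b: "b \<in> carrier R" and ab: "a \<otimes> b \<in> q"
    show "a \<in> q \<or> b \<in> q"
    proof (rule ccontr)
      assume "\<not> ?thesis"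
      then obtain u r v t where u: "u \<in> q" "r \<in> carrier R" "u \<oplus> r \<otimes> a \<in> S"
        and v: "v \<in> q" "t \<in> carrier R" "v \<oplus> t \<otimes> b \<in> S"
        using meet[OF a] meet[OF b] by blast
      have c: "u \<in> carrier R" "v \<in> carrier R" using u v q.Icarr by auto
      have "(u \<oplus> r \<otimes> a) \<otimes> (v \<oplus> t \<otimes> b)
          = (u \<otimes> (v \<oplus> t \<otimes> b) \<oplus> (r \<otimes> a) \<otimes> v) \<oplus> (r \<otimes> t) \<otimes> (a \<otimes> b)"
        using a b c u(2) v(2) by algebra
      also have "\<dots> \<in> q"
        using a b c u(1,2) v(1,2) ab
        by (intro q.a_closed q.I_l_closed[of "a \<otimes> b"] q.I_l_closed[of v] q.I_r_closed[of u]) auto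
      finally show False using mult[OF u(3) v(3)] q(3) by blast
    qed
  qed
  then show thesis using q that by blast
qed

lemma (in primeideal) pow_notin:
  assumes "r \<in> carrier R" "r \<notin> I"
  shows "r [^] (n::nat) \<notin> I"
proof (induction n)
  case 0
  then show ?case using I_notcarr one_imp_carrier by auto
next
  case (Suc n)
  then show ?case using I_prime[of "r [^] n" r] assms by auto
qed

text \<open>If \<open>s r\<^sup>n\<close> never lies in \<open>I\<close> for \<open>s \<notin> p\<close>, then a prime over \<open>I\<close> that avoids the
  multiplicative set of all these products lies inside \<open>p\<close> and misses \<open>r\<close>.\<close>

lemma (in cring) minimal_prime_iff:
  assumes I: "ideal I R" and p: "primeideal p R"
  shows "(p \<in> Var R I \<and> (\<forall>q \<in> Var R I. q \<subseteq> p \<longrightarrow> q = p)) \<longleftrightarrow>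
    I \<subseteq> p \<and> (\<forall>r\<in>p. \<exists>s\<in>carrier R - p. \<exists>n::nat. s \<otimes> r [^] n \<in> I)" (is "?L \<longleftrightarrow> ?R")
proof
  interpret p: primeideal p R by (rule p)
  have one: "\<one> \<notin> p" using p.I_notcarr p.one_imp_carrier by auto
  assume L: ?L
  have "\<exists>s\<in>carrier R - p. \<exists>n::nat. s \<otimes> r [^] n \<in> I" if r: "r \<in> p" for r
  proof (rule ccontr)
    assume none: "\<not> ?thesis"
    have rc: "r \<in> carrier R" using r p.Icarr by auto
    let ?S = "{s \<otimes> r [^] n | s n. s \<in> carrier R - p \<and> n \<in> (UNIV :: nat set)}"
    have mem: "s \<otimes> r [^] n \<in> ?S" if "s \<in> carrier R - p" for s and n :: nat
      using that by blast
    obtain q where q: "primeideal q R" "I \<subseteq> q" "q \<inter> ?S = {}"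
    proof (rule prime_avoiding_multiplicative_set[OF I, of ?S])
      show "?S \<subseteq> carrier R" using rc by auto
      show "\<one> \<in> ?S" using mem[of \<one> 0] one by simp
      show "I \<inter> ?S = {}" using none by blast
      fix x y assume "x \<in> ?S" "y \<in> ?S"
      then obtain s n t m where x: "s \<in> carrier R - p" "x = s \<otimes> r [^] (n::nat)"
        and y: "t \<in> carrier R - p" "y = t \<otimes> r [^] (m::nat)" by blast
      have "x \<otimes> y = (s \<otimes> t) \<otimes> (r [^] n \<otimes> r [^] m)"
        using x y rc by (simp add: m_ac)
      also have "\<dots> = (s \<otimes> t) \<otimes> r [^] (n + m)" using rc by (simp add: nat_pow_mult)
      also have "\<dots> \<in> ?S" using p.I_prime[of s t] x y by (intro mem) auto
      finally show "x \<otimes> y \<in> ?S" .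
    qed
    interpret q: primeideal q R by (rule q(1))
    have "q \<subseteq> p"
    proof
      fix s assume s: "s \<in> q"
      then have "s \<in> carrier R" by (rule q.Icarr)
      then show "s \<in> p" using mem[of s 0] q(3) s by auto
    qed
    then have "q = p" using L q by (auto simp: Var_def)
    moreover have "r \<notin> q" using mem[of \<one> 1] q(3) one rc by auto
    ultimately show False using r by simp
  qed
  then show ?R using L by (auto simp: Var_def)
next
  assume R: ?R
  have "q = p" if q: "primeideal q R" "I \<subseteq> q" "q \<subseteq> p" for q
  proof
    interpret q: primeideal q R by (rule q(1))
    show "p \<subseteq> q"
    proof
      fix r assume r: "r \<in> p"
      then obtain s and n :: nat where s: "s \<in> carrier R" "s \<notin> p" "s \<otimes> r [^] n \<in> I"
        using R by blast
      have rc: "r \<in> carrier R"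
        using r p by (meson ideal.Icarr primeideal.axioms(1))
      show "r \<in> q"
        using q.I_prime[of s "r [^] n"] q.pow_notin[OF rc] s rc q(2,3) by auto
    qed
  qed (rule q(3))
  then show ?L using R p by (auto simp: Var_def)
qed

section \<open>Weak assassins by elements\<close>

lemma (in module) annihilator_ideal:
  assumes x: "x \<in> carrier M"
  shows "ideal (annihilator R M x) R"
proof (rule idealI[OF R.ring_axioms])
  show "subgroup (annihilator R M x) (add_monoid R)"
  proof (rule R.add.subgroupI)
    show "annihilator R M x \<noteq> {}"
      using x smult_l_null by (auto simp: annihilator_def)
  qed (use x in \<open>auto simp: annihilator_def smult_l_distr smult_l_minus\<close>)
next
  fix r s assume r: "r \<in> annihilator R M x" and s: "s \<in> carrier R"
  then show "s \<otimes>\<^bsub>R\<^esub> r \<in> annihilator R M x"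
    using x by (simp add: annihilator_def smult_assoc1 smult_r_null)
  then show "r \<otimes>\<^bsub>R\<^esub> s \<in> annihilator R M x"
    using r s by (simp add: annihilator_def R.m_comm)
qed

text \<open>Unfolding minimality over annihilators into a condition on elements makes the weak assassins
  of a module and of its quotient comparable one witness at a time.\<close>

lemma (in module) weak_assassin_iff:
  "p \<in> weak_assassin R M \<longleftrightarrow> primeideal p R \<and>
    (\<exists>x\<in>carrier M. annihilator R M x \<subseteq> p \<and>
      (\<forall>r\<in>p. \<exists>s\<in>carrier R - p. \<exists>n::nat. s \<otimes>\<^bsub>R\<^esub> r [^]\<^bsub>R\<^esub> n \<in> annihilator R M x))"
  unfolding weak_assassin_def mem_Collect_eq
  by (intro conj_cong bex_cong refl R.minimal_prime_iff annihilator_ideal)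

section \<open>Torsion with respect to a principal ideal\<close>

lemma (in cring) cgenideal_pow:
  assumes a: "a \<in> carrier R"
  shows "(PIdl a) [^]\<^bsub>ideals_set R\<^esub> (n::nat) = PIdl (a [^] n)"
proof (induction n)
  case 0
  have "PIdl \<one> = carrier R" by (simp add: cgenideal_eq_genideal genideal_one)
  then show ?case by (simp add: ideals_set_def)
next
  case (Suc n)
  let ?J = "PIdl (a [^] n \<otimes> a)"
  have J: "ideal ?J R" using a by (intro cgenideal_ideal) auto
  have "PIdl a [^]\<^bsub>ideals_set R\<^esub> Suc n = ideal_prod R (PIdl (a [^] n)) (PIdl a)"
    using Suc by (simp add: ideals_set_def)
  also have "\<dots> = Idl ?J"
    using a by (simp add: ideal_prod_eq_genideal cgenideal_ideal cgenideal_prod)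
  also have "\<dots> = ?J"
    using genideal_minimal[OF J] genideal_self[OF ideal.Icarr[OF J, THEN subsetI]] by blast
  finally show ?case by simp
qed

lemma (in module) torsion_cgenideal_iff:
  assumes a: "a \<in> carrier R" and x: "x \<in> carrier M"
  shows "x \<in> torsion R (PIdl\<^bsub>R\<^esub> a) M \<longleftrightarrow> (\<exists>n::nat. (a [^]\<^bsub>R\<^esub> n) \<odot>\<^bsub>M\<^esub> x = \<zero>\<^bsub>M\<^esub>)"
proof -
  have "(\<forall>r\<in>PIdl\<^bsub>R\<^esub> (a [^]\<^bsub>R\<^esub> n). r \<odot>\<^bsub>M\<^esub> x = \<zero>\<^bsub>M\<^esub>) \<longleftrightarrow> (a [^]\<^bsub>R\<^esub> n) \<odot>\<^bsub>M\<^esub> x = \<zero>\<^bsub>M\<^esub>" for n :: nat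
    using a x R.cgenideal_self[of "a [^]\<^bsub>R\<^esub> n"]
    by (auto simp: cgenideal_def smult_assoc1 smult_r_null)
  then show ?thesis using a x by (simp add: torsion_def R.cgenideal_pow)
qed

lemma (in module) carrier_quotient_module:
  "carrier (quotient_module M N) = (\<lambda>x. N +>\<^bsub>M\<^esub> x) ` carrier M"
  by (auto simp: quotient_module_def A_RCOSETS_def')

lemma (in module) annihilator_quotient_module:
  assumes N: "submodule N R M" and x: "x \<in> carrier M"
  shows "annihilator R (quotient_module M N) (N +>\<^bsub>M\<^esub> x) = {r \<in> carrier R. r \<odot>\<^bsub>M\<^esub> x \<in> N}"
proof -
  interpret N: abelian_subgroup N M by (rule submodule_abelian_subgroup[OF N])
  have "N +>\<^bsub>M\<^esub> y = N \<longleftrightarrow> y \<in> N" if "y \<in> carrier M" for y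
    using that N.a_rcos_const N.a_rcos_self[of y] by auto
  moreover have "\<zero>\<^bsub>quotient_module M N\<^esub> = N" by (simp add: quotient_module_def)
  ultimately show ?thesis using x
    by (simp add: annihilator_def quotient_module_smult[OF N] cong: conj_cong)
qed

section \<open>Fairness with respect to principal ideals\<close>

theorem mainTheorem9:
  fixes R :: "('r, 'x) ring_scheme"
    and \<aa> :: "'r set"
    and M :: "('r, 'm, 'y) module_scheme"
  assumes "cring R"
    and "ideal \<aa> R"
    and "principalideal \<aa> R"
    and "module R M"
  shows "weakly_fair R \<aa> M"
proof -
  interpret module R M by (rule assms(4))
  obtain a where a: "a \<in> carrier R" and aa: "\<aa> = PIdl\<^bsub>R\<^esub> a"
    using principalideal.generate[OF assms(3)] R.cgenideal_eq_genideal by metis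
  let ?T = "torsion R \<aa> M"
  let ?Q = "quotient_module M ?T"
  let ?coset = "\<lambda>x. ?T +>\<^bsub>M\<^esub> x"
  note T = torsion_is_submodule[OF assms(2)]
  interpret Q: module R ?Q by (rule quotient_module_is_module[OF T])
  have annQ: "r \<in> annihilator R ?Q (?coset x) \<longleftrightarrow>
      r \<in> carrier R \<and> (\<exists>n::nat. r \<otimes>\<^bsub>R\<^esub> a [^]\<^bsub>R\<^esub> n \<in> annihilator R M x)"
    if x: "x \<in> carrier M" for r x
  proof -
    have "(a [^]\<^bsub>R\<^esub> n) \<odot>\<^bsub>M\<^esub> (r \<odot>\<^bsub>M\<^esub> x) = (r \<otimes>\<^bsub>R\<^esub> a [^]\<^bsub>R\<^esub> n) \<odot>\<^bsub>M\<^esub> x"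
      if "r \<in> carrier R" for n :: nat
      using a x that by (metis R.m_comm R.nat_pow_closed smult_assoc1)
    then have "r \<odot>\<^bsub>M\<^esub> x \<in> ?T \<longleftrightarrow> (\<exists>n::nat. r \<otimes>\<^bsub>R\<^esub> a [^]\<^bsub>R\<^esub> n \<in> annihilator R M x)"
      if "r \<in> carrier R"
      using a x that by (simp add: aa torsion_cgenideal_iff annihilator_def)
    then show ?thesis unfolding annihilator_quotient_module[OF T x] by blast
  qed
  have ann_le: "annihilator R M x \<subseteq> annihilator R ?Q (?coset x)" if x: "x \<in> carrier M" for x
  proof
    fix r assume r: "r \<in> annihilator R M x"
    then have "r \<in> carrier R" by (simp add: annihilator_def)
    then show "r \<in> annihilator R ?Q (?coset x)"
      using r unfolding annQ[OF x] by (intro conjI exI[of _ "0::nat"]) simp_all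
  qed
  have Var: "p \<in> Var R \<aa> \<longleftrightarrow> a \<in> p" if "primeideal p R" for p
    using that R.cgenideal_minimal[OF primeideal.axioms(1)[OF that]] R.cgenideal_self[OF a]
    unfolding Var_def aa by blast
  have "p \<in> weak_assassin R ?Q \<longleftrightarrow> p \<in> weak_assassin R M \<and> a \<notin> p" if p: "primeideal p R" for p
  proof -
    interpret p: primeideal p R by (rule p)
    have into_p: "annihilator R ?Q (?coset x) \<subseteq> p"
      if x: "x \<in> carrier M" and sub: "annihilator R M x \<subseteq> p" and "a \<notin> p" for x
    proof
      fix r assume "r \<in> annihilator R ?Q (?coset x)"
      then obtain n :: nat where "r \<in> carrier R" "r \<otimes>\<^bsub>R\<^esub> a [^]\<^bsub>R\<^esub> n \<in> p"
        using annQ[OF x] sub by blast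
      then show "r \<in> p"
        using p.I_prime[of r "a [^]\<^bsub>R\<^esub> n"] p.pow_notin[OF a \<open>a \<notin> p\<close>] a by auto
    qed
    have absorb: "\<exists>s\<in>carrier R - p. \<exists>n::nat. s \<otimes>\<^bsub>R\<^esub> r [^]\<^bsub>R\<^esub> n \<in> annihilator R M x"
      if x: "x \<in> carrier M" and "a \<notin> p" and r: "r \<in> p" and s: "s \<in> carrier R - p"
        and sr: "s \<otimes>\<^bsub>R\<^esub> r [^]\<^bsub>R\<^esub> (n::nat) \<in> annihilator R ?Q (?coset x)" for x r s n
    proof -
      have rc: "r \<in> carrier R" using r by (rule p.Icarr)
      obtain m :: nat where m: "s \<otimes>\<^bsub>R\<^esub> r [^]\<^bsub>R\<^esub> n \<otimes>\<^bsub>R\<^esub> a [^]\<^bsub>R\<^esub> m \<in> annihilator R M x"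
        using sr unfolding annQ[OF x] by blast
      \<comment> \<open>The power of \<open>a\<close> that kills the torsion moves into the multiplier outside \<open>p\<close>.\<close>
      have "s \<otimes>\<^bsub>R\<^esub> r [^]\<^bsub>R\<^esub> n \<otimes>\<^bsub>R\<^esub> a [^]\<^bsub>R\<^esub> m = (s \<otimes>\<^bsub>R\<^esub> a [^]\<^bsub>R\<^esub> m) \<otimes>\<^bsub>R\<^esub> r [^]\<^bsub>R\<^esub> n"
        using rc a s by (simp add: R.m_ac)
      moreover have "s \<otimes>\<^bsub>R\<^esub> a [^]\<^bsub>R\<^esub> m \<in> carrier R - p"
        using p.I_prime[of s "a [^]\<^bsub>R\<^esub> m"] p.pow_notin[OF a \<open>a \<notin> p\<close>] s a by auto
      ultimately show ?thesis using m by metis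
    qed
    have notin: "a \<notin> p" if x: "x \<in> carrier M" and sub: "annihilator R ?Q (?coset x) \<subseteq> p"
      and nil: "\<forall>r\<in>p. \<exists>s\<in>carrier R - p. \<exists>n::nat. s \<otimes>\<^bsub>R\<^esub> r [^]\<^bsub>R\<^esub> n \<in> annihilator R ?Q (?coset x)" for x
    proof
      \<comment> \<open>Nilpotency applied to \<open>r = a\<close>: both powers of \<open>a\<close> merge into one torsion condition.\<close>
      assume "a \<in> p"
      then obtain s and n m :: nat where s: "s \<in> carrier R" "s \<notin> p"
        and "s \<otimes>\<^bsub>R\<^esub> a [^]\<^bsub>R\<^esub> n \<otimes>\<^bsub>R\<^esub> a [^]\<^bsub>R\<^esub> m \<in> annihilator R M x"
        using nil annQ[OF x] by blast
      then have "s \<otimes>\<^bsub>R\<^esub> a [^]\<^bsub>R\<^esub> (n + m) \<in> annihilator R M x"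
        using a s by (simp add: R.m_assoc R.nat_pow_mult)
      then have "s \<in> annihilator R ?Q (?coset x)" using annQ[OF x] s by blast
      then show False using sub s by blast
    qed
    show ?thesis
    proof
      assume "p \<in> weak_assassin R ?Q"
      then obtain x where x: "x \<in> carrier M" and sub: "annihilator R ?Q (?coset x) \<subseteq> p"
        and nil: "\<forall>r\<in>p. \<exists>s\<in>carrier R - p. \<exists>n::nat. s \<otimes>\<^bsub>R\<^esub> r [^]\<^bsub>R\<^esub> n \<in> annihilator R ?Q (?coset x)"
        unfolding Q.weak_assassin_iff carrier_quotient_module by blast
      have "a \<notin> p" by (rule notin[OF x sub nil])
      have "\<exists>s\<in>carrier R - p. \<exists>n::nat. s \<otimes>\<^bsub>R\<^esub> r [^]\<^bsub>R\<^esub> n \<in> annihilator R M x"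
        if r: "r \<in> p" for r
      proof -
        obtain s and n :: nat where s: "s \<in> carrier R - p"
          and n: "s \<otimes>\<^bsub>R\<^esub> r [^]\<^bsub>R\<^esub> n \<in> annihilator R ?Q (?coset x)"
          using bspec[OF nil r] by blast
        show ?thesis by (rule absorb[OF x \<open>a \<notin> p\<close> r s n])
      qed
      moreover have "annihilator R M x \<subseteq> p" using ann_le[OF x] sub by (rule order_trans)
      ultimately have "p \<in> weak_assassin R M" unfolding weak_assassin_iff using p x by blast
      with \<open>a \<notin> p\<close> show "p \<in> weak_assassin R M \<and> a \<notin> p" by blast
    next
      assume R: "p \<in> weak_assassin R M \<and> a \<notin> p"
      then obtain x where x: "x \<in> carrier M" and sub: "annihilator R M x \<subseteq> p"
        and nil: "\<forall>r\<in>p. \<exists>s\<in>carrier R - p. \<exists>n::nat. s \<otimes>\<^bsub>R\<^esub> r [^]\<^bsub>R\<^esub> n \<in> annihilator R M x"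
        unfolding weak_assassin_iff by blast
      have "?coset x \<in> carrier ?Q" using x by (simp add: carrier_quotient_module)
      moreover have "annihilator R ?Q (?coset x) \<subseteq> p" using R by (intro into_p[OF x sub]) simp
      moreover have "\<forall>r\<in>p. \<exists>s\<in>carrier R - p. \<exists>n::nat.
          s \<otimes>\<^bsub>R\<^esub> r [^]\<^bsub>R\<^esub> n \<in> annihilator R ?Q (?coset x)"
        using nil subsetD[OF ann_le[OF x]] by meson
      ultimately show "p \<in> weak_assassin R ?Q" unfolding Q.weak_assassin_iff using p by blast
    qed
  qed
  then have mem: "p \<in> weak_assassin R ?Q \<longleftrightarrow> p \<in> weak_assassin R M - Var R \<aa>" for p
    using Var[of p] by (cases "primeideal p R") (simp_all add: weak_assassin_def)
  show ?thesis unfolding weakly_fair_def by (rule Set.set_eqI[OF mem])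
qed

end
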